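(* Let $m\ge 3$ and $n\ge 1$ be integers. If both $m$ and $n$ are even, then $\chi_{la}(C_m\odot O_n)=mn+2$; otherwise $mn+2\le\chi_{la}(C_m\odot O_n)\le mn+3$.
   Context: A local antimagic labeling of a connected graph $G=(V,E)$ is a bijection $f:E\to\{1,\dots,|E|\}$ such that, with $f^+(u)=\sum f(e)$ (sum over all edges $e$ incident to $u$), one has $f^+(u)\neq f^+(v)$ for every pair of adjacent vertices $u,v$. The color number $c(f)$ is the number of distinct values of $f^+$ on $V$. The local antimagic chromatic number $\chi_{la}(G)$ is the minimum of $c(f)$ over all local antimagic labelings $f$ of $G$. $C_m\odot O_n$ (where $O_n$ is the edgeless graph on $n$ vertices) is the graph obtained from the cycle $C_m$ on $m$ vertices by attaching $n$ pendant vertices to each vertex of the cycle: its vertices are $u_i$ and $v_{i,j}$ ($1\le i\le m$, $1\le j\le n$), and its edges are $u_iu_{i+1}$ ($1\le i\le m$, with $u_{m+1}=u_1$) and $u_iv_{i,j}$. *)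

theory Defs
  imports Main
begin

section \<open>Finite simple graphs\<close>

text \<open>A graph is a pair of a vertex set and a set of edges, each edge being the
  two-element set of its end vertices.\<close>

type_synonym 'a graph = "'a set \<times> 'a set set"

abbreviation verts :: "'a graph \<Rightarrow> 'a set" where "verts \<equiv> fst"
abbreviation edges :: "'a graph \<Rightarrow> 'a set set" where "edges \<equiv> snd"

definition simple_graph :: "'a graph \<Rightarrow> bool" where
  "simple_graph G \<longleftrightarrow> finite (verts G) \<and> (\<forall>e\<in>edges G. e \<subseteq> verts G \<and> card e = 2)"

definition adjacent :: "'a graph \<Rightarrow> 'a \<Rightarrow> 'a \<Rightarrow> bool" where
  "adjacent G u v \<longleftrightarrow> {u, v} \<in> edges G"

definition connected_graph :: "'a graph \<Rightarrow> bool" where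
  "connected_graph G \<longleftrightarrow> simple_graph G \<and> verts G \<noteq> {} \<and>
     (\<forall>u\<in>verts G. \<forall>v\<in>verts G. (adjacent G)\<^sup>*\<^sup>* u v)"

section \<open>Local antimagic labelings\<close>

definition vertex_color :: "'a graph \<Rightarrow> ('a set \<Rightarrow> nat) \<Rightarrow> 'a \<Rightarrow> nat" where
  "vertex_color G f u = (\<Sum>e\<in>{e \<in> edges G. u \<in> e}. f e)"

text \<open>Only the values of \<open>f\<close> on the edges of \<open>G\<close> matter.\<close>

definition local_antimagic_labeling :: "'a graph \<Rightarrow> ('a set \<Rightarrow> nat) \<Rightarrow> bool" where
  "local_antimagic_labeling G f \<longleftrightarrow> connected_graph G \<and>
     bij_betw f (edges G) {1..card (edges G)} \<and>
     (\<forall>u\<in>verts G. \<forall>v\<in>verts G. adjacent G u v \<longrightarrow> vertex_color G f u \<noteq> vertex_color G f v)"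

definition color_number :: "'a graph \<Rightarrow> ('a set \<Rightarrow> nat) \<Rightarrow> nat" where
  "color_number G f = card (vertex_color G f ` verts G)"

text \<open>\<open>Inf\<close> on \<open>nat\<close> is the minimum of a nonempty set, and \<open>Inf {} = 0\<close>. So
  a positive value entails that a local antimagic labeling exists.\<close>

definition local_antimagic_chromatic_number :: "'a graph \<Rightarrow> nat" (\<open>\<chi>\<^sub>l\<^sub>a\<close>) where
  "\<chi>\<^sub>l\<^sub>a G = Inf {color_number G f | f. local_antimagic_labeling G f}"

section \<open>The corona of a cycle with an edgeless graph\<close>

datatype corona_vertex = U nat | V nat nat

text \<open>For \<open>1 \<le> i \<le> m\<close> the successor of \<open>i\<close> on the cycle is \<open>i mod m + 1\<close>, which is
  \<open>i + 1\<close> for \<open>i < m\<close> and \<open>1\<close> for \<open>i = m\<close>.\<close>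

definition cycle_corona :: "nat \<Rightarrow> nat \<Rightarrow> corona_vertex graph" where
  "cycle_corona m n =
     ({U i | i. i \<in> {1..m}} \<union> {V i j | i j. i \<in> {1..m} \<and> j \<in> {1..n}},
      {{U i, U (i mod m + 1)} | i. i \<in> {1..m}} \<union>
      {{U i, V i j} | i j. i \<in> {1..m} \<and> j \<in> {1..n}})"

lemma simple_graph_cycle_corona:
  assumes "m \<ge> 2"
  shows "simple_graph (cycle_corona m n)"
proof -
  have fin: "finite (verts (cycle_corona m n))"
    using finite_image_set2[of "\<lambda>i. i \<in> {1..m}" "\<lambda>j. j \<in> {1..n}" V]
    by (simp add: cycle_corona_def finite_image_set)
  have ne: "i \<noteq> i mod m + 1" "i mod m + 1 \<in> {1..m}" if "i \<in> {1..m}" for i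
    using that assms by (cases "i = m"; auto simp: Suc_le_eq)+
  have "e \<subseteq> verts (cycle_corona m n) \<and> card e = 2" if e: "e \<in> edges (cycle_corona m n)" for e
  proof -
    consider i where "i \<in> {1..m}" "e = {U i, U (i mod m + 1)}"
      | i j where "i \<in> {1..m}" "j \<in> {1..n}" "e = {U i, V i j}"
      using e unfolding cycle_corona_def by auto
    then show ?thesis
    proof cases
      case 1
      then show ?thesis using ne[of i] by (simp add: cycle_corona_def)
    next
      case 2
      then show ?thesis by (simp add: cycle_corona_def)
    qed
  qed
  with fin show ?thesis by (simp add: simple_graph_def)
qed

lemma connected_graph_cycle_corona:
  assumes "m \<ge> 2"
  shows "connected_graph (cycle_corona m n)"
proof -
  let ?G = "cycle_corona m n"
  have sym: "symp (adjacent ?G)"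
    by (simp add: symp_def adjacent_def insert_commute)
  have cyc: "(adjacent ?G)\<^sup>*\<^sup>* (U 1) (U i)" if "i \<in> {1..m}" for i
  proof -
    have "1 \<le> i \<Longrightarrow> i \<le> m \<Longrightarrow> (adjacent ?G)\<^sup>*\<^sup>* (U 1) (U i)"
    proof (induction i rule: dec_induct)
      case (step k)
      then have "k \<in> {1..m}" "k mod m + 1 = Suc k" by auto
      then have "adjacent ?G (U k) (U (Suc k))"
        unfolding adjacent_def cycle_corona_def snd_conv by (intro UnI1 CollectI) metis
      with step show ?case by (meson Suc_leD rtranclp.rtrancl_into_rtrancl)
    qed simp
    with that show ?thesis by simp
  qed
  have from1: "(adjacent ?G)\<^sup>*\<^sup>* (U 1) w" if w: "w \<in> verts ?G" for w
  proof -
    consider i where "i \<in> {1..m}" "w = U i"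
      | i j where "i \<in> {1..m}" "j \<in> {1..n}" "w = V i j"
      using w unfolding cycle_corona_def by auto
    then show ?thesis
    proof cases
      case 1
      then show ?thesis using cyc by simp
    next
      case 2
      then have "adjacent ?G (U i) w"
        unfolding adjacent_def cycle_corona_def snd_conv by (intro UnI2 CollectI) metis
      with cyc[OF 2(1)] show ?thesis by (rule rtranclp.rtrancl_into_rtrancl)
    qed
  qed
  have "(adjacent ?G)\<^sup>*\<^sup>* v w" if "v \<in> verts ?G" "w \<in> verts ?G" for v w
    using from1[OF that(1)] from1[OF that(2)] sym
    by (meson rtranclp_trans sympD symp_rtranclp)
  moreover have "U 1 \<in> verts ?G"
    using assms by (simp add: cycle_corona_def)
  ultimately show ?thesis
    using simple_graph_cycle_corona[OF assms] by (auto simp: connected_graph_def)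
qed

end

theory Submission imports Defs begin

text \<open>The \<open>mn\<close> pendant edges give \<open>mn\<close> distinct colors. If at most one further color occurs, the
  cycle vertices with a pendant color form a set \<open>S\<close> of size \<open>s\<close> that meets every cycle edge.
  Their colors are at most \<open>m(n + 1)\<close>, but they add up to at least the sum of \<open>m + sn\<close> distinct
  positive labels, which exceeds \<open>sm(n + 1)\<close>.

  For the upper bound, two further pendant edges per cycle vertex can be given the new labels
  \<open>N + i\<close> and \<open>N + 2m + 1 - i\<close> with \<open>N = m(n + 1)\<close>, which shifts all colors of cycle vertices
  by the same amount. This reduces the claim to \<open>n = 0\<close> (\<open>m\<close> odd), \<open>n = 1\<close> and \<open>n = 2\<close>
  (\<open>m\<close> even). There the small and the large labels alternate along the cycle, so that the
  partial sums at the cycle vertices are almost constant or almost an arithmetic progression,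
  and the pendant labels even them out.\<close>

section \<open>Edges and vertex colors of the corona\<close>

text \<open>The edges of \<open>cycle_corona m n\<close> are indexed by \<open>{1..m} \<times> {..n}\<close>, with second index 0
  for the cycle edges.\<close>

definition corona_edge :: "nat \<Rightarrow> nat \<times> nat \<Rightarrow> corona_vertex set" where
  "corona_edge m = (\<lambda>(i, j). if j = 0 then {U i, U (i mod m + 1)} else {U i, V i j})"

definition cycle_pred :: "nat \<Rightarrow> nat \<Rightarrow> nat" where
  "cycle_pred m i = (if i = 1 then m else i - 1)"

lemma cycle_succ_eq_iff:
  assumes "i \<in> {1..m}" "k \<in> {1..m}"
  shows "k mod m + 1 = i \<longleftrightarrow> k = cycle_pred m i"
  using assms by (cases "k = m") (auto simp: cycle_pred_def)

lemma cycle_pred_in: "i \<in> {1..m} \<Longrightarrow> cycle_pred m i \<in> {1..m}"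
  by (auto simp: cycle_pred_def)

lemma cycle_succ_in: "i \<in> {1..m} \<Longrightarrow> i mod m + 1 \<in> {1..m}" for i m :: nat
  by (cases "i = m") auto

lemma edges_cycle_corona:
  "edges (cycle_corona m n) = corona_edge m ` ({1..m} \<times> {..n})"
proof -
  have "{1..m} \<times> {..n} = {1..m} \<times> {0} \<union> {1..m} \<times> {1..n}" by auto
  moreover have "corona_edge m ` ({1..m} \<times> {0}) = {{U i, U (i mod m + 1)} | i. i \<in> {1..m}}"
  proof -
    have "{1..m} \<times> {0::nat} = (\<lambda>i. (i, 0)) ` {1..m}" by auto
    then show ?thesis by (auto simp: corona_edge_def image_image)
  qed
  moreover have "corona_edge m ` ({1..m} \<times> {1..n}) = {{U i, V i j} | i j. i \<in> {1..m} \<and> j \<in> {1..n}}"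
  proof -
    have "corona_edge m ` ({1..m} \<times> {1..n}) = (\<lambda>(i, j). {U i, V i j}) ` ({1..m} \<times> {1..n})"
      by (rule image_cong) (auto simp: corona_edge_def)
    then show ?thesis by (auto; blast)
  qed
  ultimately show ?thesis
    unfolding cycle_corona_def snd_conv by (simp only: image_Un)
qed

text \<open>Equal cycle edges with different indices would have to be matched crosswise, so that
  each index is the cyclic successor of the other. This happens on a cycle of length 2 and is
  excluded by \<open>m \<ge> 3\<close>.\<close>

lemma inj_on_corona_edge:
  assumes "m \<ge> 3"
  shows "inj_on (corona_edge m) ({1..m} \<times> {..n})"
proof (rule inj_onI, clarify)
  fix i j i' j'
  assume i: "i \<in> {1..m}" and i': "i' \<in> {1..m}" and eq: "corona_edge m (i, j) = corona_edge m (i', j')"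
  have aux: "i = i'" if "i mod m + 1 = i'" "i' mod m + 1 = i"
    using that i i' assms by (cases "i = m"; cases "i' = m") auto
  show "i = i' \<and> j = j'"
    using eq aux by (auto simp: corona_edge_def doubleton_eq_iff split: if_splits)
qed

lemma card_edges_cycle_corona:
  assumes "m \<ge> 3"
  shows "card (edges (cycle_corona m n)) = m * (n + 1)"
  unfolding edges_cycle_corona card_image[OF inj_on_corona_edge[OF assms]] by simp

lemma vertex_color_corona:
  assumes "m \<ge> 3"
  shows "vertex_color (cycle_corona m n) f v =
    (\<Sum>d\<in>{d \<in> {1..m} \<times> {..n}. v \<in> corona_edge m d}. f (corona_edge m d))"
proof -
  have "{e \<in> edges (cycle_corona m n). v \<in> e}
      = corona_edge m ` {d \<in> {1..m} \<times> {..n}. v \<in> corona_edge m d}"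
    unfolding edges_cycle_corona by blast
  moreover have "inj_on (corona_edge m) {d \<in> {1..m} \<times> {..n}. v \<in> corona_edge m d}"
    by (rule inj_on_subset[OF inj_on_corona_edge[OF assms]]) auto
  ultimately show ?thesis
    by (simp add: vertex_color_def sum.reindex)
qed

lemma edges_at_U:
  assumes "i \<in> {1..m}"
  shows "{d \<in> {1..m} \<times> {..n}. U i \<in> corona_edge m d} = insert (cycle_pred m i, 0) ({i} \<times> {..n})"
proof -
  have "U i \<in> corona_edge m (k, j) \<longleftrightarrow> k = i \<or> (k = cycle_pred m i \<and> j = 0)" if "k \<in> {1..m}" for k j
    using cycle_succ_eq_iff[OF assms that] by (auto simp: corona_edge_def)
  then show ?thesis using assms cycle_pred_in[OF assms] by auto
qed

lemma vertex_color_U: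
  assumes "m \<ge> 3" "i \<in> {1..m}"
  shows "vertex_color (cycle_corona m n) f (U i) =
    f (corona_edge m (cycle_pred m i, 0)) + (\<Sum>j\<le>n. f (corona_edge m (i, j)))"
proof -
  have "cycle_pred m i \<noteq> i" using assms by (auto simp: cycle_pred_def)
  moreover have "{i} \<times> {..n} = Pair i ` {..n}" by auto
  ultimately show ?thesis
    unfolding vertex_color_corona[OF assms(1)] edges_at_U[OF assms(2)]
    by (simp add: sum.reindex image_iff inj_on_def)
qed

lemma vertex_color_V:
  assumes "m \<ge> 3" "i \<in> {1..m}" "j \<in> {1..n}"
  shows "vertex_color (cycle_corona m n) f (V i j) = f (corona_edge m (i, j))"
proof -
  have "{d \<in> {1..m} \<times> {..n}. V i j \<in> corona_edge m d} = {(i, j)}"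
    using assms by (auto simp: corona_edge_def split: if_splits)
  then show ?thesis by (simp add: vertex_color_corona[OF assms(1)])
qed

lemma verts_cycle_corona:
  "verts (cycle_corona m n) = U ` {1..m} \<union> (\<lambda>(i, j). V i j) ` ({1..m} \<times> {1..n})"
  by (auto simp: cycle_corona_def)

lemma vertex_color_image:
  assumes "m \<ge> 3"
  shows "vertex_color (cycle_corona m n) f ` verts (cycle_corona m n) =
    (\<lambda>i. vertex_color (cycle_corona m n) f (U i)) ` {1..m} \<union>
    (\<lambda>d. f (corona_edge m d)) ` ({1..m} \<times> {1..n})"
proof -
  have "(\<lambda>(i, j). vertex_color (cycle_corona m n) f (V i j)) ` ({1..m} \<times> {1..n})
      = (\<lambda>d. f (corona_edge m d)) ` ({1..m} \<times> {1..n})"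
    by (rule image_cong) (auto simp: vertex_color_V[OF assms])
  then show ?thesis
    by (simp add: verts_cycle_corona image_Un image_image case_prod_unfold)
qed

section \<open>The lower bound\<close>

text \<open>Only an inequality, because the sets may overlap: in the lower bound a cycle edge with
  both ends in \<open>S\<close> lies in two of the sets \<open>A i\<close>.\<close>

lemma sum_UN_le:
  fixes f :: "'a \<Rightarrow> nat"
  assumes "finite I" "\<And>i. i \<in> I \<Longrightarrow> finite (A i)"
  shows "sum f (\<Union>i\<in>I. A i) \<le> (\<Sum>i\<in>I. sum f (A i))"
  using assms
proof (induction rule: finite_induct)
  case (insert x F)
  have "sum f (\<Union>i\<in>insert x F. A i) \<le> sum f (A x) + sum f (\<Union>i\<in>F. A i)"
    using insert.hyps insert.prems by (simp add: sum_Un_nat)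
  with insert show ?case by (simp add: le_trans)
qed simp

text \<open>The maximum of a set of \<open>k\<close> positive integers is at least \<open>k\<close>,
  so adding it last raises the sum by at least the step from one triangular number to the
  next.\<close>

lemma card_mult_Suc_le_sum:
  fixes X :: "nat set"
  assumes "finite X" "0 \<notin> X"
  shows "card X * (card X + 1) \<le> 2 * \<Sum>X"
  using assms
proof (induction rule: finite_linorder_max_induct)
  case (insert b A)
  have "insert b A \<subseteq> {1..b}"
    using insert.hyps insert.prems by (auto simp: Suc_le_eq less_imp_le intro: gr0I)
  then have "card (insert b A) \<le> card {1..b}" by (intro card_mono) auto
  moreover have "b \<notin> A" using insert.hyps by auto
  ultimately show ?case using insert by (simp add: algebra_simps)
qed simp

lemma color_number_ge:
  assumes m: "m \<ge> 3" and n: "n \<ge> 1"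
    and f: "local_antimagic_labeling (cycle_corona m n) f"
  shows "m * n + 2 \<le> color_number (cycle_corona m n) f"
proof (rule ccontr)
  assume less: "\<not> ?thesis"
  let ?G = "cycle_corona m n" and ?D = "{1..m} \<times> {..n}"
  define l where "l d = f (corona_edge m d)" for d
  define c where "c i = vertex_color ?G f (U i)" for i
  define P where "P = l ` ({1..m} \<times> {1..n})"
  define S where "S = {i \<in> {1..m}. c i \<in> P}"
  have bij: "bij_betw l ?D {1..m * (n + 1)}"
  proof -
    have "bij_betw f (corona_edge m ` ?D) {1..m * (n + 1)}"
      using f unfolding local_antimagic_labeling_def card_edges_cycle_corona[OF m]
      by (simp add: edges_cycle_corona)
    with inj_on_corona_edge[OF m] have "bij_betw (f \<circ> corona_edge m) ?D {1..m * (n + 1)}"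
      by (intro bij_betw_trans) (auto simp: bij_betw_def)
    then show ?thesis by (simp only: l_def[abs_def] comp_def)
  qed
  then have inj: "inj_on l ?D" and range: "l ` ?D = {1..m * (n + 1)}"
    by (auto simp: bij_betw_def)
  have finP: "finite P" by (simp add: P_def)
  have "inj_on l ({1..m} \<times> {1..n})" by (rule inj_on_subset[OF inj]) auto
  then have cardP: "card P = m * n" by (simp add: P_def card_image)
  have "card (c ` {1..m} \<union> P) < m * n + 2"
    using less by (simp add: color_number_def vertex_color_image[OF m] P_def l_def c_def)
  moreover have "c ` {1..m} \<union> P = (c ` {1..m} - P) \<union> P" by auto
  moreover have "card ((c ` {1..m} - P) \<union> P) = card (c ` {1..m} - P) + card P"
    using finP by (intro card_Un_disjoint) auto
  ultimately have "card (c ` {1..m} - P) \<le> 1" using cardP by simp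
  then have one: "x = y" if "x \<in> c ` {1..m} - P" "y \<in> c ` {1..m} - P" for x y
  proof -
    have "finite (c ` {1..m} - P)" by simp
    with \<open>card (c ` {1..m} - P) \<le> 1\<close> that show ?thesis by (metis One_nat_def card_le_Suc0_iff_eq)
  qed
  \<comment> \<open>\<open>S\<close> is a vertex cover of the cycle: at most one color lies outside
    \<open>P\<close>, and two adjacent cycle vertices outside \<open>S\<close> would share
    it.\<close>
  have cover: "i \<in> S \<or> i mod m + 1 \<in> S" if i: "i \<in> {1..m}" for i
  proof (rule ccontr)
    assume "\<not> ?thesis"
    with i cycle_succ_in[OF i] have "c i \<in> c ` {1..m} - P" "c (i mod m + 1) \<in> c ` {1..m} - P"
      by (simp_all add: S_def)
    then have "c i = c (i mod m + 1)" by (rule one)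
    moreover have "adjacent ?G (U i) (U (i mod m + 1))"
      unfolding adjacent_def edges_cycle_corona
      by (rule image_eqI[of _ _ "(i, 0)"]) (use i in \<open>auto simp: corona_edge_def\<close>)
    moreover have "U i \<in> verts ?G" "U (i mod m + 1) \<in> verts ?G"
      using i cycle_succ_in[OF i] by (auto simp: verts_cycle_corona)
    ultimately show False
      using f unfolding local_antimagic_labeling_def c_def by blast
  qed
  define A where "A i = insert (cycle_pred m i, 0) ({i} \<times> {..n})" for i
  have SD: "S \<subseteq> {1..m}" and finS: "finite S" by (auto simp: S_def)
  have c_sum: "c i = sum l (A i)" if "i \<in> {1..m}" for i
    unfolding c_def A_def l_def vertex_color_corona[OF m] edges_at_U[OF that] ..
  \<comment> \<open>All cycle edges and the pendant edges at \<open>S\<close>. By the covering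
    property each of them contributes to a color \<open>c i\<close> with \<open>i\<close> in
    \<open>S\<close>.\<close>
  let ?D' = "{1..m} \<times> {0} \<union> S \<times> {1..n}"
  have sub: "?D' \<subseteq> (\<Union>i\<in>S. A i)"
  proof -
    have "(i, 0) \<in> (\<Union>i\<in>S. A i)" if i: "i \<in> {1..m}" for i
    proof (cases "i \<in> S")
      case False
      then have s: "i mod m + 1 \<in> S" using cover i by blast
      have "i = cycle_pred m (i mod m + 1)"
        using cycle_succ_eq_iff[OF cycle_succ_in[OF i] i] by simp
      then have "(i, 0) \<in> A (i mod m + 1)" by (simp add: A_def)
      with s show ?thesis by blast
    qed (auto simp: A_def)
    then show ?thesis by (auto simp: A_def)
  qed
  have D': "?D' \<subseteq> ?D" using SD by auto
  have cardD': "card ?D' = m + card S * n"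
    using finS by (subst card_Un_disjoint) (auto simp: card_cartesian_product)
  have "card ?D' * (card ?D' + 1) \<le> 2 * sum l ?D'"
  proof -
    have injD': "inj_on l ?D'" using inj D' by (rule inj_on_subset)
    have "0 \<notin> l ` ?D'" using D' range by fastforce
    then have "card (l ` ?D') * (card (l ` ?D') + 1) \<le> 2 * \<Sum>(l ` ?D')"
      using finS by (intro card_mult_Suc_le_sum) auto
    then show ?thesis by (simp only: card_image[OF injD'] sum.reindex[OF injD'] comp_def)
  qed
  also have "sum l ?D' \<le> sum l (\<Union>i\<in>S. A i)"
    using sub finS by (intro sum_mono2) (auto simp: A_def)
  also have "\<dots> \<le> (\<Sum>i\<in>S. sum l (A i))"
    using finS by (intro sum_UN_le) (auto simp: A_def)
  also have "\<dots> = sum c S" using c_sum SD by (intro sum.cong) auto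
  also have "\<dots> \<le> (\<Sum>i\<in>S. m * (n + 1))"
  proof (rule sum_mono)
    fix i assume "i \<in> S"
    then have "c i \<in> l ` ?D" by (auto simp: S_def P_def)
    then show "c i \<le> m * (n + 1)" using range by auto
  qed
  finally have le: "(m + card S * n) * (m + card S * n + 1) \<le> 2 * (card S * (m * (n + 1)))"
    using cardD' by simp
  have "card S \<le> m" using card_mono[OF _ SD] by simp
  then obtain t where t: "m = card S + t" using le_Suc_ex by blast
  obtain n' where n': "n = n' + 1" using n by (metis add.commute le_Suc_ex)
  \<comment> \<open>With \<open>s = card S\<close> and \<open>a = s * (n + 1)\<close>, the right
    side minus the left side is \<open>a * s * n' + t * t + a + t\<close>. This is positive because
    \<open>s + t = m > 0\<close>.\<close>
  have "2 * (card S * (m * (n + 1))) < (m + card S * n) * (m + card S * n + 1)"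
    using m unfolding t n' by (simp add: algebra_simps; arith)
  with le show False by simp
qed

section \<open>Labelings as functions of the edge index\<close>

definition index_color :: "nat \<Rightarrow> nat \<Rightarrow> (nat \<Rightarrow> nat \<Rightarrow> nat) \<Rightarrow> nat \<Rightarrow> nat" where
  "index_color m n l i = l (cycle_pred m i) 0 + (\<Sum>j\<le>n. l i j)"

text \<open>Here \<open>k\<close> bounds only the number of colors on the cycle vertices. The case
  \<open>n = 0\<close>, a labeling of the bare cycle, is allowed so that it can start the induction
  for even \<open>n\<close>.\<close>

definition index_labeling :: "nat \<Rightarrow> nat \<Rightarrow> nat \<Rightarrow> (nat \<Rightarrow> nat \<Rightarrow> nat) \<Rightarrow> bool" where
  "index_labeling m n k l \<longleftrightarrow>
     inj_on (\<lambda>(i, j). l i j) ({1..m} \<times> {..n}) \<and>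
     (\<forall>i\<in>{1..m}. \<forall>j\<le>n. l i j \<in> {1..m * (n + 1)}) \<and>
     (\<forall>i\<in>{1..m}. index_color m n l i \<noteq> index_color m n l (i mod m + 1)) \<and>
     card (index_color m n l ` {1..m}) \<le> k"

text \<open>An injection into a range of the same size is a bijection. Pendant edges need no
  condition: the color of \<open>U i\<close> contains the label of the pendant edge and also the
  positive label of the preceding cycle edge, so it exceeds the color of
  \<open>V i j\<close>.\<close>

lemma ex_labeling_if_index_labeling:
  assumes m: "m \<ge> 3" and l: "index_labeling m n k l"
  shows "\<exists>f. local_antimagic_labeling (cycle_corona m n) f \<and>
    color_number (cycle_corona m n) f \<le> m * n + k"
proof (intro exI conjI)
  let ?G = "cycle_corona m n" and ?D = "{1..m} \<times> {..n}" and ?l = "\<lambda>(i, j). l i j"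
  define f where "f e = ?l (inv_into ?D (corona_edge m) e)" for e
  have f: "f (corona_edge m d) = ?l d" if "d \<in> ?D" for d
    by (simp only: f_def inv_into_f_f[OF inj_on_corona_edge[OF m] that])
  have color: "vertex_color ?G f (U i) = index_color m n l i" if "i \<in> {1..m}" for i
    using cycle_pred_in[OF that] that
    by (simp add: vertex_color_U[OF m that] index_color_def f)
  have inj: "inj_on ?l ?D" using l by (simp add: index_labeling_def)
  have "bij_betw ?l ?D {1..m * (n + 1)}"
  proof -
    have "?l ` ?D \<subseteq> {1..m * (n + 1)}" using l unfolding index_labeling_def by auto
    moreover have "card (?l ` ?D) = card {1..m * (n + 1)}" using card_image[OF inj] by simp
    ultimately show ?thesis using inj by (simp add: bij_betw_def card_subset_eq)
  qed
  moreover have "bij_betw (inv_into ?D (corona_edge m)) (edges ?G) ?D"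
    unfolding edges_cycle_corona
    using inj_on_corona_edge[OF m] by (intro bij_betw_inv_into) (simp add: bij_betw_def)
  ultimately have "bij_betw (?l \<circ> inv_into ?D (corona_edge m)) (edges ?G) {1..m * (n + 1)}"
    by (rule bij_betw_trans[rotated])
  then have bij: "bij_betw f (edges ?G) {1..m * (n + 1)}"
    by (simp add: f_def[abs_def] comp_def)
  have pos: "l i j > 0" if "i \<in> {1..m}" "j \<le> n" for i j
    using l that unfolding index_labeling_def by (meson atLeastAtMost_iff less_le_trans zero_less_one)
  have ne: "vertex_color ?G f x \<noteq> vertex_color ?G f y \<and> vertex_color ?G f y \<noteq> vertex_color ?G f x"
    if dD: "d \<in> ?D" and edge: "corona_edge m d = {x, y}" for d x y
  proof -
    obtain i j where d: "d = (i, j)" "i \<in> {1..m}" "j \<le> n" using dD by auto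
    show ?thesis
    proof (cases "j = 0")
      case True
      then have "{x, y} = {U i, U (i mod m + 1)}" using edge d by (simp add: corona_edge_def)
      moreover have "index_color m n l i \<noteq> index_color m n l (i mod m + 1)"
        using l d unfolding index_labeling_def by blast
      ultimately show ?thesis
        using color[OF d(2)] color[OF cycle_succ_in[OF d(2)]] by (auto simp: doubleton_eq_iff)
    next
      case False
      then have xy: "{x, y} = {U i, V i j}" using edge d by (simp add: corona_edge_def)
      have "vertex_color ?G f (V i j) = l i j"
        using vertex_color_V[OF m d(2), of j n f] False d f by simp
      moreover have "l i j < index_color m n l i"
        using member_le_sum[of j "{..n}" "l i"] d pos[OF cycle_pred_in[OF d(2)], of 0]
        by (simp add: index_color_def)
      ultimately show ?thesis
        using xy color[OF d(2)] by (auto simp: doubleton_eq_iff)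
    qed
  qed
  show "local_antimagic_labeling ?G f"
    unfolding local_antimagic_labeling_def
  proof (intro conjI ballI impI)
    show "connected_graph ?G" using m by (intro connected_graph_cycle_corona) simp
    show "bij_betw f (edges ?G) {1..card (edges ?G)}"
      using bij by (simp only: card_edges_cycle_corona[OF m])
    show "vertex_color ?G f x \<noteq> vertex_color ?G f y" if "adjacent ?G x y" for x y
      using that ne unfolding adjacent_def edges_cycle_corona by (metis imageE)
  qed
  have "color_number ?G f =
      card (index_color m n l ` {1..m} \<union> (\<lambda>d. f (corona_edge m d)) ` ({1..m} \<times> {1..n}))"
    unfolding color_number_def vertex_color_image[OF m] using color by simp
  also have "\<dots> \<le> card (index_color m n l ` {1..m})
      + card ((\<lambda>d. f (corona_edge m d)) ` ({1..m} \<times> {1..n}))"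
    by (rule card_Un_le)
  also have "\<dots> \<le> k + m * n"
    using l card_image_le[of "{1..m} \<times> {1..n}" "\<lambda>d. f (corona_edge m d)"]
    unfolding index_labeling_def by (intro add_mono) auto
  finally show "color_number ?G f \<le> m * n + k" by simp
qed

section \<open>Two further pendant edges at each cycle vertex\<close>

lemma index_labeling_add_two:
  assumes l: "index_labeling m n k l"
  shows "\<exists>l'. index_labeling m (n + 2) k l'"
proof
  define N where "N = m * (n + 1)"
  \<comment> \<open>The labels \<open>N + 1, ..., N + m\<close> in increasing order and
    \<open>N + m + 1, ..., N + 2 * m\<close> in decreasing order exhaust the new range; the two at
    each vertex add up to \<open>2 * N + 2 * m + 1\<close>.\<close>
  define l' where "l' i j = (if j \<le> n then l i j
    else if j = n + 1 then N + i else N + 2 * m + 1 - i)" for i j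
  have l_le: "1 \<le> l i j \<and> l i j \<le> N" if "i \<in> {1..m}" "j \<le> n" for i j
    using l that unfolding index_labeling_def N_def by (meson atLeastAtMost_iff)
  have inj: "i = i' \<and> j = j'"
    if "i \<in> {1..m}" "i' \<in> {1..m}" "j \<le> n" "j' \<le> n" "l i j = l i' j'" for i j i' j'
    using l that inj_onD[of "\<lambda>(i, j). l i j" "{1..m} \<times> {..n}" "(i, j)" "(i', j')"]
    unfolding index_labeling_def by simp
  have color: "index_color m (n + 2) l' i = index_color m n l i + (2 * N + 2 * m + 1)"
    if "i \<in> {1..m}" for i
    using that by (simp add: index_color_def l'_def)
  have range: "m * (n + 2 + 1) = N + 2 * m" by (simp add: N_def algebra_simps)
  show "index_labeling m (n + 2) k l'"
    unfolding index_labeling_def range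
  proof (intro conjI ballI allI impI)
    show "inj_on (\<lambda>(i, j). l' i j) ({1..m} \<times> {..n + 2})"
    proof (rule inj_onI, clarify)
      fix i j i' j'
      assume a: "i \<in> {1..m}" "i' \<in> {1..m}" "j \<le> n + 2" "j' \<le> n + 2" "l' i j = l' i' j'"
      show "i = i' \<and> j = j'"
        using a l_le[OF a(1), of j] l_le[OF a(2), of j'] inj[OF a(1,2), of j j']
        by (auto simp: l'_def split: if_splits)
    qed
    show "l' i j \<in> {1..N + 2 * m}" if "i \<in> {1..m}" "j \<le> n + 2" for i j
      using that l_le[OF that(1), of j] by (auto simp: l'_def)
    show "index_color m (n + 2) l' i \<noteq> index_color m (n + 2) l' (i mod m + 1)"
      if "i \<in> {1..m}" for i
      unfolding color[OF that] color[OF cycle_succ_in[OF that]]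
      using l that unfolding index_labeling_def by (simp only: add_right_cancel) blast
    have "index_color m (n + 2) l' ` {1..m}
        = (\<lambda>x. x + (2 * N + 2 * m + 1)) ` index_color m n l ` {1..m}"
      unfolding image_image by (intro image_cong refl color)
    then have "card (index_color m (n + 2) l' ` {1..m}) \<le> card (index_color m n l ` {1..m})"
      by (simp only: card_image_le finite_imageI finite_atLeastAtMost)
    with l show "card (index_color m (n + 2) l' ` {1..m}) \<le> k"
      unfolding index_labeling_def by linarith
  qed
qed

lemma index_labeling_add_even:
  assumes "index_labeling m n k l"
  shows "\<exists>l'. index_labeling m (n + 2 * r) k l'"
proof (induction r)
  case 0
  with assms show ?case by auto
next
  case (Suc r)
  then show ?case using index_labeling_add_two[of m "n + 2 * r" k] by (auto simp: add.assoc)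
qed

text \<open>Suited to labelings in closed form: the wraparound from \<open>m\<close> to 1 is a
  separate condition, so no \<open>mod\<close> remains, and the list \<open>X\<close> of possible
  colors bounds their number even if it has repetitions.\<close>

lemma index_labelingI:
  assumes "\<And>i j i' j'. \<lbrakk>1 \<le> i; i \<le> m; j \<le> n; 1 \<le> i'; i' \<le> m; j' \<le> n; l i j = l i' j'\<rbrakk> \<Longrightarrow> i = i' \<and> j = j'"
    and "\<And>i j. \<lbrakk>1 \<le> i; i \<le> m; j \<le> n\<rbrakk> \<Longrightarrow> 1 \<le> l i j \<and> l i j \<le> m * (n + 1)"
    and color: "\<And>i. \<lbrakk>1 \<le> i; i \<le> m\<rbrakk> \<Longrightarrow> index_color m n l i = C i"
    and "\<And>i. \<lbrakk>1 \<le> i; i < m\<rbrakk> \<Longrightarrow> C i \<noteq> C (i + 1)" and "C m \<noteq> C 1" "m \<ge> 1"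
    and C: "C ` {1..m} \<subseteq> set X" "length X \<le> k"
  shows "index_labeling m n k l"
  unfolding index_labeling_def
proof (intro conjI ballI allI impI)
  show "inj_on (\<lambda>(i, j). l i j) ({1..m} \<times> {..n})"
    using assms(1) by (auto simp: inj_on_def)
  show "l i j \<in> {1..m * (n + 1)}" if "i \<in> {1..m}" "j \<le> n" for i j
    using assms(2)[of i j] that by auto
  show "index_color m n l i \<noteq> index_color m n l (i mod m + 1)" if "i \<in> {1..m}" for i
  proof (cases "i = m")
    case True
    then show ?thesis using color[of m] color[of 1] assms(5,6) by simp
  next
    case False
    then show ?thesis using color[of i] color[of "i+1"] assms(4)[of i] that by simp
  qed
  have "index_color m n l ` {1..m} = C ` {1..m}"
    using color by (intro image_cong) auto
  then have "card (index_color m n l ` {1..m}) \<le> card (set X)"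
    using C by (simp add: card_mono)
  also have "\<dots> \<le> length X" by (rule card_length)
  finally show "card (index_color m n l ` {1..m}) \<le> k" using C by simp
qed

section \<open>Base labelings\<close>

text \<open>Around the cycle the labels are 1, m, 2, m - 1, and so on. Consecutive sums alternate
  between m + 1 and m + 2, except at vertex 1, where (m + 1)/2 and 1 meet.\<close>

lemma index_labeling_odd_zero:
  assumes "m \<ge> 3" "odd m"
  shows "\<exists>l. index_labeling m 0 3 l"
proof
  let ?l = "\<lambda>(i :: nat) (j :: nat). if odd i then (i + 1) div 2 else m + 1 - i div 2"
  show "index_labeling m 0 3 ?l"
  proof (rule index_labelingI)
    let ?C = "\<lambda>i :: nat. if i = 1 then (m + 3) div 2 else if even i then m + 1 else m + 2"
    show "?C ` {1..m} \<subseteq> set [(m + 3) div 2, m + 1, m + 2]" by auto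
    show "?C i \<noteq> ?C (i + 1)" if "1 \<le> i" "i < m" for i
      using that assms by auto
    show "i = i' \<and> j = j'" if "1 \<le> i" "i \<le> m" "j \<le> 0" "1 \<le> i'" "i' \<le> m" "j' \<le> 0" "?l i j = ?l i' j'"
      for i j i' j'
      using that by (auto elim!: oddE evenE split: if_splits)
    show "1 \<le> ?l i j \<and> ?l i j \<le> m * (0 + 1)" if "1 \<le> i" "i \<le> m" "j \<le> 0" for i j
      using that assms by (auto elim!: oddE evenE)
    show "index_color m 0 ?l i = ?C i" if "1 \<le> i" "i \<le> m" for i
      using that assms by (auto simp: index_color_def cycle_pred_def elim!: oddE evenE)
  qed (use assms in auto)
qed

text \<open>The cycle edges take the labels up to \<open>m\<close> and the pendant edges those
  above, so injectivity can be checked for \<open>g\<close> and \<open>h\<close> separately.\<close>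

lemma index_labeling_oneI:
  assumes g_inj: "\<And>i i'. \<lbrakk>1 \<le> i; i \<le> m; 1 \<le> i'; i' \<le> m; g i = g i'\<rbrakk> \<Longrightarrow> i = i'"
    and h_inj: "\<And>i i'. \<lbrakk>1 \<le> i; i \<le> m; 1 \<le> i'; i' \<le> m; h i = h i'\<rbrakk> \<Longrightarrow> i = i'"
    and g_le: "\<And>i. \<lbrakk>1 \<le> i; i \<le> m\<rbrakk> \<Longrightarrow> 1 \<le> g i \<and> g i \<le> m"
    and h_le: "\<And>i. \<lbrakk>1 \<le> i; i \<le> m\<rbrakk> \<Longrightarrow> m < h i \<and> h i \<le> 2 * m"
    and color: "\<And>i. \<lbrakk>1 \<le> i; i \<le> m\<rbrakk> \<Longrightarrow> g (cycle_pred m i) + g i + h i = C i"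
    and "\<And>i. \<lbrakk>1 \<le> i; i < m\<rbrakk> \<Longrightarrow> C i \<noteq> C (i + 1)" and "C m \<noteq> C 1" "m \<ge> 1"
    and "C ` {1..m} \<subseteq> set X" "length X \<le> k"
  shows "index_labeling m 1 k (\<lambda>i j. if j = 0 then g i else h i)" (is "index_labeling m 1 k ?l")
proof (rule index_labelingI)
  show "i = i' \<and> j = j'" if "1 \<le> i" "i \<le> m" "j \<le> 1" "1 \<le> i'" "i' \<le> m" "j' \<le> 1" "?l i j = ?l i' j'"
    for i j i' j'
    using that g_inj[of i i'] h_inj[of i i'] g_le[of i] g_le[of i'] h_le[of i] h_le[of i']
    by (auto split: if_splits)
  show "1 \<le> ?l i j \<and> ?l i j \<le> m * (1 + 1)" if "1 \<le> i" "i \<le> m" "j \<le> 1" for i j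
    using that g_le[of i] h_le[of i] by auto
  show "index_color m 1 ?l i = C i" if "1 \<le> i" "i \<le> m" for i
    using color[OF that] by (simp add: index_color_def)
qed fact+

text \<open>With \<open>b = (m + 1) div 2\<close>, the two cycle labels at vertex \<open>i\<close>
  add up to \<open>b + i\<close>, also at \<open>i = 1\<close>. Pendant labels
  \<open>2 * m + 1 - i\<close> would make all colors equal; rotating them by one place among the odd
  vertices lowers the odd colors by 2, except that vertex \<open>m\<close> receives the largest
  label \<open>2 * m\<close>.\<close>

lemma index_labeling_odd_one:
  assumes "m \<ge> 3" "odd m"
  shows "\<exists>l. index_labeling m 1 3 l"
proof -
  let ?g = "\<lambda>i. if odd i then (i + 1) div 2 else (m + 1) div 2 + i div 2"
  let ?h = "\<lambda>i. if even i then 2 * m + 1 - i else if i = m then 2 * m else 2 * m - 1 - i"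
  let ?b = "(m + 1) div 2"
  let ?C = "\<lambda>i. if i = m then ?b + 3 * m else if even i then ?b + 2 * m + 1 else ?b + 2 * m - 1"
  have "index_labeling m 1 3 (\<lambda>i j. if j = 0 then ?g i else ?h i)"
  proof (rule index_labeling_oneI)
    show "?C ` {1..m} \<subseteq> set [?b + 3 * m, ?b + 2 * m + 1, ?b + 2 * m - 1]" by auto
    show "?C i \<noteq> ?C (i + 1)" if "1 \<le> i" "i < m" for i
      using that assms by auto
    show "i = i'" if "1 \<le> i" "i \<le> m" "1 \<le> i'" "i' \<le> m" "?g i = ?g i'" for i i'
      using that assms by (auto elim!: oddE evenE split: if_splits)
    show "i = i'" if "1 \<le> i" "i \<le> m" "1 \<le> i'" "i' \<le> m" "?h i = ?h i'" for i i'
    proof -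
      \<comment> \<open>Every alternative but the first contradicts parity.\<close>
      have "i = i' \<or> i = i' + 2 \<and> even i \<and> odd i' \<or> i' = i + 2 \<and> odd i \<and> even i'
          \<or> i = 1 \<and> even i \<or> i' = 1 \<and> even i'"
        using that by (auto split: if_splits)
      then show ?thesis by auto
    qed
    show "1 \<le> ?g i \<and> ?g i \<le> m" "m < ?h i \<and> ?h i \<le> 2 * m" if "1 \<le> i" "i \<le> m" for i
      using that assms by (auto elim!: oddE evenE)
    show "?g (cycle_pred m i) + ?g i + ?h i = ?C i" if "1 \<le> i" "i \<le> m" for i
      using that assms by (auto simp: cycle_pred_def elim!: oddE evenE)
  qed (use assms in auto)
  then show ?thesis by blast
qed

text \<open>For \<open>m = 4\<close> the construction for even \<open>m\<close> below would give two adjacent vertices the color 12.\<close>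

lemma index_labeling_four_one: "\<exists>l. index_labeling 4 1 3 l"
proof -
  let ?g = "\<lambda>i. [1, 2, 4, 3] ! (i - 1) :: nat" and ?h = "\<lambda>i. [7, 6, 5, 8] ! (i - 1) :: nat"
  let ?C = "\<lambda>i. [11, 9, 11, 15] ! (i - 1) :: nat"
  have i4: "i = 1 \<or> i = 2 \<or> i = 3 \<or> i = 4" if "1 \<le> i" "i \<le> 4" for i :: nat
    using that by auto
  have "index_labeling 4 1 3 (\<lambda>i j. if j = 0 then ?g i else ?h i)"
  proof (rule index_labeling_oneI)
    show "?C ` {1..4} \<subseteq> set [11, 9, 15]"
    proof (rule image_subsetI)
      fix i :: nat assume "i \<in> {1..4}"
      with i4[of i] show "?C i \<in> set [11, 9, 15]" by auto
    qed
    show "?C i \<noteq> ?C (i + 1)" if "1 \<le> i" "i < 4" for i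
      using that i4[of i] by auto
    show "i = i'" if "1 \<le> i" "i \<le> 4" "1 \<le> i'" "i' \<le> 4" "?g i = ?g i'" for i i'
      using that i4[of i] i4[of i'] by auto
    show "i = i'" if "1 \<le> i" "i \<le> 4" "1 \<le> i'" "i' \<le> 4" "?h i = ?h i'" for i i'
      using that i4[of i] i4[of i'] by auto
    show "1 \<le> ?g i \<and> ?g i \<le> 4" "4 < ?h i \<and> ?h i \<le> 2 * 4" if "1 \<le> i" "i \<le> 4" for i
      using i4[OF that] by auto
    show "?g (cycle_pred 4 i) + ?g i + ?h i = ?C i" if "1 \<le> i" "i \<le> 4" for i
      using i4[OF that] by (auto simp: cycle_pred_def)
  qed auto
  then show ?thesis by blast
qed

text \<open>The two cycle labels at vertex \<open>i\<close> add up to \<open>m div 2 + i\<close>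
  except at vertex 1, where the labels \<open>m\<close> and 1 meet. The pendant labels cancel the
  term \<open>i\<close> and leave a difference of 2 between the even and the other odd
  vertices.\<close>

lemma index_labeling_even_one:
  assumes "m \<ge> 6" "even m"
  shows "\<exists>l. index_labeling m 1 3 l"
proof -
  let ?g = "\<lambda>i. if odd i then (i + 1) div 2 else m div 2 + i div 2"
  let ?h = "\<lambda>i. if even i then 2 * m + 2 - i else 2 * m - i"
  let ?b = "m div 2"
  let ?C = "\<lambda>i. if i = 1 then 3 * m else if even i then ?b + 2 * m + 2 else ?b + 2 * m"
  have "index_labeling m 1 3 (\<lambda>i j. if j = 0 then ?g i else ?h i)"
  proof (rule index_labeling_oneI)
    show "?C ` {1..m} \<subseteq> set [3 * m, ?b + 2 * m + 2, ?b + 2 * m]" by auto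
    show "?C i \<noteq> ?C (i + 1)" if "1 \<le> i" "i < m" for i
      using that assms by auto
    show "i = i'" if "1 \<le> i" "i \<le> m" "1 \<le> i'" "i' \<le> m" "?g i = ?g i'" for i i'
      using that assms by (auto elim!: oddE evenE split: if_splits)
    show "i = i'" if "1 \<le> i" "i \<le> m" "1 \<le> i'" "i' \<le> m" "?h i = ?h i'" for i i'
    proof -
      have "i = i' \<or> i = i' + 2 \<and> even i \<and> odd i' \<or> i' = i + 2 \<and> odd i \<and> even i'"
        using that by (auto split: if_splits)
      then show ?thesis by auto
    qed
    show "1 \<le> ?g i \<and> ?g i \<le> m" if "1 \<le> i" "i \<le> m" for i
      using that assms by (auto elim!: oddE evenE)
    show "m < ?h i \<and> ?h i \<le> 2 * m" if "1 \<le> i" "i \<le> m" for i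
      \<comment> \<open>For odd \<open>i\<close> the strict bound \<open>m < 2 * m - i\<close> needs
        \<open>i < m\<close>, which holds because \<open>m\<close> is even.\<close>
      using that assms(2) by (cases "i = m") auto
    show "?g (cycle_pred m i) + ?g i + ?h i = ?C i" if "1 \<le> i" "i \<le> m" for i
      using that assms by (auto simp: cycle_pred_def elim!: oddE evenE)
  qed (use assms in auto)
  then show ?thesis by blast
qed

lemma index_labeling_even_two:
  assumes "m \<ge> 3" "even m"
  shows "\<exists>l. index_labeling m 2 2 l"
proof
  \<comment> \<open>The cycle sums are m + 1 at even vertices, m + 2 at odd ones and m/2 + 2 at
    vertex 1. Odd vertices share the pendant labels from m + 1 to 2m, even ones those above. The
    middle label m + m/2 goes to vertex 1, where it makes up the missing m/2.\<close>
  let ?l = "\<lambda>(i :: nat) (j :: nat). if j = 0 then (if odd i then (i + 1) div 2 else m + 1 - i div 2)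
    else if j = 1 then (if even i then 2 * m + i div 2 else if i = 1 then m + m div 2 else m + i div 2)
    else (if even i then 3 * m + 1 - i div 2 else 2 * m - i div 2)"
  show "index_labeling m 2 2 ?l"
  proof (rule index_labelingI)
    let ?C = "\<lambda>i :: nat. if odd i then 4 * m + 2 else 6 * m + 2"
    show "?C ` {1..m} \<subseteq> set [4 * m + 2, 6 * m + 2]" by auto
    show "?C i \<noteq> ?C (i + 1)" if "1 \<le> i" "i < m" for i
      using that assms by auto
    show "i = i' \<and> j = j'" if "1 \<le> i" "i \<le> m" "j \<le> 2" "1 \<le> i'" "i' \<le> m" "j' \<le> 2" "?l i j = ?l i' j'"
      for i j i' j'
    proof -
      have "j = 0 \<or> j = 1 \<or> j = 2" "j' = 0 \<or> j' = 1 \<or> j' = 2" using that by auto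
      then show ?thesis
        using that assms by (auto elim!: oddE evenE split: if_splits; presburger)
    qed
    show "1 \<le> ?l i j \<and> ?l i j \<le> m * (2 + 1)" if "1 \<le> i" "i \<le> m" "j \<le> 2" for i j
      using that assms by (auto elim!: oddE evenE)
    show "index_color m 2 ?l i = ?C i" if "1 \<le> i" "i \<le> m" for i
    proof -
      have "{..2::nat} = {0, 1, 2}" by auto
      then show ?thesis
        using that assms by (auto simp: index_color_def cycle_pred_def elim!: oddE evenE)
    qed
  qed (use assms in auto)
qed

section \<open>From labelings to the chromatic number\<close>

lemma chromatic_number_bounds:
  assumes "m \<ge> 3" "n \<ge> 1" "index_labeling m n k l"
  shows "m * n + 2 \<le> \<chi>\<^sub>l\<^sub>a (cycle_corona m n) \<and> \<chi>\<^sub>l\<^sub>a (cycle_corona m n) \<le> m * n + k"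
proof -
  let ?X = "{color_number (cycle_corona m n) f | f. local_antimagic_labeling (cycle_corona m n) f}"
  obtain f where f: "local_antimagic_labeling (cycle_corona m n) f"
    "color_number (cycle_corona m n) f \<le> m * n + k"
    using ex_labeling_if_index_labeling assms by blast
  \<comment> \<open>A labeling exists, so the infimum is attained and the lower bound for color
    numbers applies to it.\<close>
  then have "Inf ?X \<in> ?X" by (intro Inf_nat_def1) auto
  moreover have "Inf ?X \<le> color_number (cycle_corona m n) f" using f by (intro wellorder_Inf_le1) auto
  ultimately show ?thesis
    using f(2) color_number_ge[OF assms(1,2)]
    unfolding local_antimagic_chromatic_number_def by auto
qed

theorem theorem2p12:
  fixes m n :: nat
  assumes "m \<ge> 3" and "n \<ge> 1"
  shows "(even m \<and> even n \<longrightarrow> \<chi>\<^sub>l\<^sub>a (cycle_corona m n) = m * n + 2) \<and>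
         (\<not> (even m \<and> even n) \<longrightarrow>
            m * n + 2 \<le> \<chi>\<^sub>l\<^sub>a (cycle_corona m n) \<and> \<chi>\<^sub>l\<^sub>a (cycle_corona m n) \<le> m * n + 3)"
proof (intro conjI impI)
  assume e: "even m \<and> even n"
  then obtain l where "index_labeling m 2 2 l" using index_labeling_even_two assms by blast
  moreover obtain r where "n = 2 + 2 * r"
  proof -
    have "n = 2 + 2 * ((n - 2) div 2)" using e assms(2) by presburger
    then show thesis by (rule that)
  qed
  ultimately obtain l where "index_labeling m n 2 l" using index_labeling_add_even by metis
  then show "\<chi>\<^sub>l\<^sub>a (cycle_corona m n) = m * n + 2"
    using chromatic_number_bounds[OF assms] by (meson le_antisym)
next
  assume o: "\<not> (even m \<and> even n)"
  \<comment> \<open>The base \<open>b\<close> is the parity of \<open>n\<close>: 0 for even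
    \<open>n\<close>, where \<open>m\<close> must be odd, and 1 for odd \<open>n\<close>.\<close>
  have "\<exists>b l r. index_labeling m b 3 l \<and> n = b + 2 * r"
  proof (cases "even n")
    case True
    then show ?thesis using o index_labeling_odd_zero[OF assms(1)] by (metis add_0 dvd_def)
  next
    case False
    have "m = 4 \<or> m \<ge> 6 \<or> odd m" using assms(1) by presburger
    then have "\<exists>l. index_labeling m 1 3 l"
      using index_labeling_odd_one[OF assms(1)] index_labeling_even_one index_labeling_four_one by blast
    with False show ?thesis by (metis oddE add.commute)
  qed
  then obtain l where "index_labeling m n 3 l" using index_labeling_add_even by metis
  with chromatic_number_bounds[OF assms]
  show "m * n + 2 \<le> \<chi>\<^sub>l\<^sub>a (cycle_corona m n)" "\<chi>\<^sub>l\<^sub>a (cycle_corona m n) \<le> m * n + 3" by blast+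
qed

end
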